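(* Let $\mathbf{X}=(\mathbf{x},\mathbf{y})$, $\mathbf{U}=(\mathbf{u},\mathbf{v})\in\mathbb{R}^3\times\mathbb{R}^3$, with $\varphi=\|\mathbf{x}\|\neq0$ (and, for the statements about the $b_i$, also $\beta\neq 0$). The non-zero directional derivatives of the coefficients $a_1,a_2,a_3,a_4,b_2,b_4$ (viewed as functions of $\mathbf{X}$) are $$(\mathrm{D}_{\mathbf{X}}a_i)(\mathbf{U})=(\mathbf{x}^T\mathbf{u})\,\bar a_i(\mathbf{x})\ (i=1,\dots,4),\qquad (\mathrm{D}_{\mathbf{X}}b_i)(\mathbf{U})=(\mathbf{x}^T\mathbf{u})\,\bar b_i(\mathbf{x})\ (i=2,4),$$ where $\bar a_i,\bar b_i$ depend on $\mathbf{x}$ only and are given by $$\bar a_1=\tfrac14\beta+\tfrac1{\varphi^2}\left(\tfrac52\alpha-2\beta-\tfrac12\right),$$ $$\bar a_2=\tfrac1{\varphi^2}\left(\tfrac74\beta-\tfrac12\alpha-\tfrac{15}2\delta\right)=\tfrac1{\varphi^2}\left(\tfrac74\beta-\tfrac12\alpha\right)+\tfrac1{\varphi^4}\tfrac{15}{2}(\alpha-1),$$ $$\bar a_3=\tfrac1{\varphi^2}\bar a_1,\qquad \bar a_4=\tfrac1{\varphi^2}\bar a_2,$$ $$\bar b_2=\tfrac1{\varphi^2}\left(\tfrac34-\tfrac32\tfrac{\delta}{\beta}\right)+\tfrac1{\varphi^4}\left(\tfrac{\alpha+3\alpha^2}{\beta^2}-4\right)=\tfrac{3}{4\varphi^2}+\tfrac1{\varphi^4}\left(\gamma\left(\tfrac32+\tfrac1\beta+3\gamma\right)-\tfrac3{2\beta}-4\right),$$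 $$\bar b_4=\tfrac1{\varphi^4}\left(\tfrac14-\tfrac12\tfrac\delta\beta\right)+\tfrac1{\varphi^6}\left((1+\alpha)\left(\tfrac{\alpha}{\beta^2}+\tfrac1\beta\right)-4\right)=\tfrac1{4\varphi^4}+\tfrac1{\varphi^6}\left(\tfrac1{2\beta}+\tfrac32\gamma+\tfrac\gamma\beta+\gamma^2-4\right).$$ Their limits for $\mathbf{x}\to\mathbf{0}$ are $\bar a_1(\mathbf{0})=0$, $\bar a_2(\mathbf{0})=0$, $\bar a_3(\mathbf{0})=-\frac1{180}$, $\bar a_4(\mathbf{0})=-\frac1{1260}$, $\bar b_2(\mathbf{0})=0$, $\bar b_4(\mathbf{0})=-\frac1{7560}$.
   Context: For $\mathbf{x}\in\mathbb{R}^3$ put $\varphi:=\|\mathbf{x}\|$ (Euclidean norm), $\mathrm{sinc}\,t=\sin t/t$, and $\alpha:=\mathrm{sinc}\,\varphi$, $\beta:=\mathrm{sinc}^2\frac{\varphi}{2}$ (the square of $\mathrm{sinc}\frac\varphi2$), $\gamma:=\alpha/\beta$, $\delta:=\frac{1-\alpha}{\varphi^2}$. The coefficients are $a_1=\beta-\frac\alpha2$, $a_2=\frac12\left(5\delta-\frac\beta2\right)$, $a_3=\frac1{2\varphi^2}(\beta-\alpha)$, $a_4=\frac1{2\varphi^2}\left(3\delta-\frac\beta2\right)$, $b_1=-\frac12$, $b_2=\frac1{\varphi^2}\left(2-\frac{1+3\alpha}{2\beta}\right)$, $b_3=0$, $b_4=\frac1{\varphi^4}\left(1-\frac{1+\alpha}{2\beta}\right)$.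 For a function $g$ of $\mathbf{X}=(\mathbf{x},\mathbf{y})\in\mathbb{R}^6$, $(\mathrm{D}_{\mathbf{X}}g)(\mathbf{U}):=\frac{d}{dt}g(\mathbf{X}+t\mathbf{U})|_{t=0}$. *)

theory Defs
  imports "HOL-Analysis.Analysis" "HOL-Probability.Sinc_Integral"
begin

(* sinc is the library's function, continued by sinc 0 = 1. *)

definition \<alpha> :: "real^3 \<Rightarrow> real" where
  "\<alpha> x = sinc (norm x)"

definition \<beta> :: "real^3 \<Rightarrow> real" where
  "\<beta> x = (sinc (norm x / 2))\<^sup>2"

definition \<gamma> :: "real^3 \<Rightarrow> real" where
  "\<gamma> x = \<alpha> x / \<beta> x"

definition \<delta> :: "real^3 \<Rightarrow> real" where
  "\<delta> x = (1 - \<alpha> x) / (norm x)\<^sup>2"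

definition a1 :: "real^3 \<Rightarrow> real" where
  "a1 x = \<beta> x - \<alpha> x / 2"

definition a2 :: "real^3 \<Rightarrow> real" where
  "a2 x = 1 / 2 * (5 * \<delta> x - \<beta> x / 2)"

definition a3 :: "real^3 \<Rightarrow> real" where
  "a3 x = 1 / (2 * (norm x)\<^sup>2) * (\<beta> x - \<alpha> x)"

definition a4 :: "real^3 \<Rightarrow> real" where
  "a4 x = 1 / (2 * (norm x)\<^sup>2) * (3 * \<delta> x - \<beta> x / 2)"

definition b1 :: "real^3 \<Rightarrow> real" where
  "b1 x = - 1 / 2"

definition b2 :: "real^3 \<Rightarrow> real" where
  "b2 x = 1 / (norm x)\<^sup>2 * (2 - (1 + 3 * \<alpha> x) / (2 * \<beta> x))"

definition b3 :: "real^3 \<Rightarrow> real" where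
  "b3 x = 0"

definition b4 :: "real^3 \<Rightarrow> real" where
  "b4 x = 1 / (norm x)^4 * (1 - (1 + \<alpha> x) / (2 * \<beta> x))"

definition abar1 :: "real^3 \<Rightarrow> real" where
  "abar1 x = 1 / 4 * \<beta> x + 1 / (norm x)\<^sup>2 * (5 / 2 * \<alpha> x - 2 * \<beta> x - 1 / 2)"

definition abar2 :: "real^3 \<Rightarrow> real" where
  "abar2 x = 1 / (norm x)\<^sup>2 * (7 / 4 * \<beta> x - 1 / 2 * \<alpha> x - 15 / 2 * \<delta> x)"

definition abar3 :: "real^3 \<Rightarrow> real" where
  "abar3 x = 1 / (norm x)\<^sup>2 * abar1 x"

definition abar4 :: "real^3 \<Rightarrow> real" where
  "abar4 x = 1 / (norm x)\<^sup>2 * abar2 x"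

definition bbar2 :: "real^3 \<Rightarrow> real" where
  "bbar2 x = 1 / (norm x)\<^sup>2 * (3 / 4 - 3 / 2 * (\<delta> x / \<beta> x))
    + 1 / (norm x)^4 * ((\<alpha> x + 3 * (\<alpha> x)\<^sup>2) / (\<beta> x)\<^sup>2 - 4)"

definition bbar4 :: "real^3 \<Rightarrow> real" where
  "bbar4 x = 1 / (norm x)^4 * (1 / 4 - 1 / 2 * (\<delta> x / \<beta> x))
    + 1 / (norm x)^6 * ((1 + \<alpha> x) * (\<alpha> x / (\<beta> x)\<^sup>2 + 1 / \<beta> x) - 4)"

(* As a relation, it asserts that the derivative at t = 0 exists and has the value d. *)
definition has_dir_deriv ::
    "('a::real_normed_vector \<Rightarrow> real) \<Rightarrow> 'a \<Rightarrow> 'a \<Rightarrow> real \<Rightarrow> bool" where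
  "has_dir_deriv g X U d \<longleftrightarrow> ((\<lambda>t. g (X + t *\<^sub>R U)) has_real_derivative d) (at 0)"

end

theory Submission
  imports Defs "HOL-Real_Asymp.Real_Asymp"
begin

text \<open>
  All coefficients are rational functions of \<open>\<phi> = norm x\<close>, \<open>\<alpha>\<close> and \<open>\<beta>\<close>, so their directional
  derivatives follow from three basic ones by the rules of calculus.  With \<open>c = x \<bullet> u\<close>, the basic
  derivatives are \<open>c / \<phi>\<close>, \<open>c (\<delta> - \<beta> / 2)\<close> and \<open>2 c (\<alpha> - \<beta>) / \<phi>\<^sup>2\<close>.  The point is that they are again
  rational in \<open>\<phi>\<close>, \<open>\<alpha>\<close> and \<open>\<beta>\<close>: the half-angle identities \<open>cos \<phi> = 1 - \<phi>\<^sup>2 \<beta> / 2\<close> and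
  \<open>sinc (\<phi> / 2) cos (\<phi> / 2) = \<alpha>\<close> absorb the cosines that differentiating \<open>sinc\<close> brings in.  Hence
  each formula, divided by \<open>c\<close>, is an identity of rational functions in three variables.  The lemmas
  \<open>sinc_norm_along_line\<close>, \<open>\<alpha>_along_line\<close> and \<open>\<beta>_along_line\<close> carry this part.

  Since the functions in question are radial, their limits at the origin are one-sided limits of
  functions of \<open>\<phi> > 0\<close> (lemma \<open>tendsto_radial\<close>), and these come from the Taylor expansions of sine.
  Negative powers of \<open>\<phi>\<close> cancel: for instance \<open>a1 = 1 / 2 - \<phi>\<^sup>4 / 720 + \<dots>\<close>, whence
  \<open>abar1 = - \<phi>\<^sup>2 / 180 + \<dots>\<close>, so that \<open>abar1\<close> tends to \<open>0\<close> and \<open>abar3 = abar1 / \<phi>\<^sup>2\<close> to \<open>- 1 / 180\<close>.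
\<close>

section \<open>Derivatives of the basic radial quantities along a line\<close>

lemma has_dir_deriv_fst:
  "has_dir_deriv (\<lambda>X. g (fst X)) (x, y) (u, v) d \<longleftrightarrow>
     ((\<lambda>t. g (x + t *\<^sub>R u)) has_real_derivative d) (at 0)"
  by (simp add: has_dir_deriv_def)

lemma norm_along_line:
  fixes x u :: "'a::real_inner"
  assumes "x \<noteq> 0"
  shows "((\<lambda>t. norm (x + t *\<^sub>R u)) has_real_derivative (x \<bullet> u) / norm x) (at 0)"
proof -
  \<comment> \<open>The square of the norm is a quadratic polynomial in \<open>t\<close>, positive at \<open>t = 0\<close>; then take roots.\<close>
  have eq: "(norm (x + t *\<^sub>R u))\<^sup>2 = x \<bullet> x + 2 * t * (x \<bullet> u) + t\<^sup>2 * (u \<bullet> u)" for t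
    unfolding power2_norm_eq_inner
    by (simp add: inner_commute algebra_simps power2_eq_square)
  have "((\<lambda>t. (norm (x + t *\<^sub>R u))\<^sup>2) has_real_derivative 2 * (x \<bullet> u)) (at 0)"
    unfolding eq by (auto intro!: derivative_eq_intros)
  then have "((\<lambda>t. sqrt ((norm (x + t *\<^sub>R u))\<^sup>2)) has_real_derivative
           inverse (sqrt ((norm (x + 0 *\<^sub>R u))\<^sup>2)) / 2 * (2 * (x \<bullet> u))) (at 0)"
    using assms
    by (intro DERIV_chain2[OF DERIV_real_sqrt]) auto
  then show ?thesis
    by (simp add: field_simps)
qed

lemma DERIV_sinc:
  assumes "r \<noteq> 0"
  shows "(sinc has_real_derivative (cos r - sinc r) / r) (at r)"
proof -
  have "((\<lambda>s. sin s / s) has_real_derivative (cos r - sinc r) / r) (at r)"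
    using assms by (auto intro!: derivative_eq_intros simp: field_simps)
  then show ?thesis
    by (rule has_field_derivative_transform_within_open[of _ _ _ "- {0}"]) (use assms in auto)
qed

text \<open>
  Since \<open>r sinc' r = cos r - sinc r\<close>, the inner factor \<open>1 / k\<close> of the chain rule cancels, and \<open>k\<close> is
  left in the arguments of \<open>sinc\<close> and \<open>cos\<close> only.  The cases \<open>k = 1\<close> and \<open>k = 2\<close> give \<open>\<alpha>\<close> and \<open>\<beta>\<close>.
\<close>

lemma sinc_norm_along_line:
  fixes x u :: "'a::real_inner"
  assumes "x \<noteq> 0" "k \<noteq> 0"
  shows "((\<lambda>t. sinc (norm (x + t *\<^sub>R u) / k)) has_real_derivative
           (x \<bullet> u) * ((cos (norm x / k) - sinc (norm x / k)) / (norm x)\<^sup>2)) (at 0)"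
    (is "(_ has_real_derivative ?D) _")
proof -
  let ?r = "norm x / k"
  have "((\<lambda>t. norm (x + t *\<^sub>R u) / k) has_real_derivative (x \<bullet> u) / norm x / k) (at 0)"
    using norm_along_line[OF assms(1)] by (rule DERIV_cdivide)
  moreover have "(sinc has_real_derivative (cos ?r - sinc ?r) / ?r) (at (norm (x + 0 *\<^sub>R u) / k))"
    using DERIV_sinc[of ?r] assms by simp
  ultimately have "((\<lambda>t. sinc (norm (x + t *\<^sub>R u) / k)) has_real_derivative
      (cos ?r - sinc ?r) / ?r * ((x \<bullet> u) / norm x / k)) (at 0)"
    by (rule DERIV_chain2[rotated])
  moreover have "(cos ?r - sinc ?r) / ?r * ((x \<bullet> u) / norm x / k) = ?D"
    using assms by (simp add: power2_eq_square)
  ultimately show ?thesis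
    by (simp only:)
qed

text \<open>
  The next two identities eliminate the cosines: the first from the derivative of \<open>\<alpha>\<close>, the
  second from that of \<open>\<beta>\<close>, where \<open>cos (\<phi> / 2)\<close> occurs multiplied by \<open>sinc (\<phi> / 2)\<close>.
\<close>

lemma cos_norm_eq_\<beta>: "cos (norm x) = 1 - (norm x)\<^sup>2 * \<beta> x / 2"
proof (cases "x = 0")
  case False
  have "cos (norm x) = 1 - 2 * (sin (norm x / 2))\<^sup>2"
    using cos_double_sin[of "norm x / 2"] by simp
  with False show ?thesis
    by (simp add: \<beta>_def field_simps power2_eq_square)
qed simp

lemma sinc_half_cos_half:
  assumes "x \<noteq> 0"
  shows "sinc (norm x / 2) * cos (norm x / 2) = \<alpha> x"
  using assms sin_double[of "norm x / 2"] by (simp add: \<alpha>_def)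

lemma \<alpha>_along_line:
  assumes "x \<noteq> 0"
  shows "((\<lambda>t. \<alpha> (x + t *\<^sub>R u)) has_real_derivative (x \<bullet> u) * (\<delta> x - \<beta> x / 2)) (at 0)"
proof -
  have "((\<lambda>t. \<alpha> (x + t *\<^sub>R u)) has_real_derivative
           (x \<bullet> u) * ((cos (norm x) - \<alpha> x) / (norm x)\<^sup>2)) (at 0)"
    using sinc_norm_along_line[OF assms, of 1 u] by (simp only: \<alpha>_def div_by_1 one_neq_zero simp_thms)
  moreover have "(cos (norm x) - \<alpha> x) / (norm x)\<^sup>2 = \<delta> x - \<beta> x / 2"
    using assms by (simp add: cos_norm_eq_\<beta> \<delta>_def field_simps)
  ultimately show ?thesis
    by simp
qed

lemma \<beta>_along_line:
  assumes "x \<noteq> 0"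
  shows "((\<lambda>t. \<beta> (x + t *\<^sub>R u)) has_real_derivative (x \<bullet> u) * (2 * (\<alpha> x - \<beta> x) / (norm x)\<^sup>2)) (at 0)"
proof -
  \<comment> \<open>Naming \<open>sinc (\<phi> / 2)\<close> hides its case distinction, so that the power rule applies to \<open>\<beta> = s\<^sup>2\<close>.\<close>
  define s where "s z = sinc (norm z / 2)" for z :: "real^3"
  let ?c = "cos (norm x / 2)"
  have s': "((\<lambda>t. s (x + t *\<^sub>R u)) has_real_derivative
      (x \<bullet> u) * ((?c - s x) / (norm x)\<^sup>2)) (at 0)"
    unfolding s_def by (rule sinc_norm_along_line) (use assms in auto)
  have "\<beta> z = (s z)\<^sup>2" for z
    by (simp only: \<beta>_def s_def)
  moreover have "s x * ?c = \<alpha> x"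
    unfolding s_def by (rule sinc_half_cos_half[OF assms])
  ultimately show ?thesis
    using assms by (auto intro!: derivative_eq_intros s' simp: field_simps power2_eq_square)
qed

lemma \<delta>_along_line:
  assumes "x \<noteq> 0"
  shows "((\<lambda>t. \<delta> (x + t *\<^sub>R u)) has_real_derivative
           (x \<bullet> u) * ((\<beta> x / 2 - 3 * \<delta> x) / (norm x)\<^sup>2)) (at 0)"
  unfolding \<delta>_def
  by (rule derivative_eq_intros \<alpha>_along_line norm_along_line assms refl | (simp add: assms; fail))+
     (use assms in \<open>simp add: \<delta>_def divide_simps\<close>,
      simp add: algebra_simps eval_nat_numeral)

section \<open>Derivatives of the coefficients\<close>

text \<open>
  Each derivative below is found by the sum, product and quotient rules; clearing denominators turns
  its agreement with the stated closed form into a polynomial identity in \<open>\<phi>\<close>, \<open>\<alpha>\<close>, \<open>\<beta>\<close> and \<open>x \<bullet> u\<close>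
  (for some coefficients it is convenient to keep \<open>\<delta>\<close> as a further variable).  The alternative
  \<open>simp add: assms; fail\<close> serves the side conditions that denominators do not vanish at \<open>t = 0\<close>.
\<close>

lemmas basic_along_line = \<alpha>_along_line \<beta>_along_line \<delta>_along_line norm_along_line

lemma a1_along_line:
  assumes "x \<noteq> 0"
  shows "((\<lambda>t. a1 (x + t *\<^sub>R u)) has_real_derivative (x \<bullet> u) * abar1 x) (at 0)"
  unfolding a1_def
  by (rule derivative_eq_intros basic_along_line assms refl | (simp add: assms; fail))+
     (use assms in \<open>simp add: abar1_def \<delta>_def divide_simps\<close>,
      simp add: algebra_simps eval_nat_numeral)

lemma a2_along_line:
  assumes "x \<noteq> 0"
  shows "((\<lambda>t. a2 (x + t *\<^sub>R u)) has_real_derivative (x \<bullet> u) * abar2 x) (at 0)"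
  unfolding a2_def
  by (rule derivative_eq_intros basic_along_line assms refl | (simp add: assms; fail))+
     (use assms in \<open>simp add: abar2_def divide_simps\<close>,
      simp add: algebra_simps eval_nat_numeral)

lemma a3_along_line:
  assumes "x \<noteq> 0"
  shows "((\<lambda>t. a3 (x + t *\<^sub>R u)) has_real_derivative (x \<bullet> u) * abar3 x) (at 0)"
  unfolding a3_def
  by (rule derivative_eq_intros basic_along_line assms refl | (simp add: assms; fail))+
     (use assms in \<open>simp add: abar3_def abar1_def \<delta>_def divide_simps\<close>,
      simp add: algebra_simps eval_nat_numeral)

lemma a4_along_line:
  assumes "x \<noteq> 0"
  shows "((\<lambda>t. a4 (x + t *\<^sub>R u)) has_real_derivative (x \<bullet> u) * abar4 x) (at 0)"
  unfolding a4_def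
  by (rule derivative_eq_intros basic_along_line assms refl | (simp add: assms; fail))+
     (use assms in \<open>simp add: abar4_def abar2_def divide_simps\<close>,
      simp add: algebra_simps eval_nat_numeral)

lemma b2_along_line:
  assumes "x \<noteq> 0" "\<beta> x \<noteq> 0"
  shows "((\<lambda>t. b2 (x + t *\<^sub>R u)) has_real_derivative (x \<bullet> u) * bbar2 x) (at 0)"
  unfolding b2_def
  by (rule derivative_eq_intros basic_along_line assms refl | (simp add: assms; fail))+
     (use assms in \<open>simp add: bbar2_def divide_simps\<close>,
      simp add: algebra_simps eval_nat_numeral)

lemma b4_along_line:
  assumes "x \<noteq> 0" "\<beta> x \<noteq> 0"
  shows "((\<lambda>t. b4 (x + t *\<^sub>R u)) has_real_derivative (x \<bullet> u) * bbar4 x) (at 0)"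
  unfolding b4_def
  by (rule derivative_eq_intros basic_along_line assms refl | (simp add: assms; fail))+
     (use assms in \<open>simp add: bbar4_def divide_simps\<close>,
      simp add: algebra_simps eval_nat_numeral)

section \<open>Alternative forms of the derivatives\<close>

text \<open>
  Substituting \<open>\<delta> = (1 - \<alpha>) / \<phi>\<^sup>2\<close>, and hence \<open>\<delta> / \<beta> = (1 / \<beta> - \<gamma>) / \<phi>\<^sup>2\<close>, moves the terms in \<open>\<delta>\<close> to the
  next lower power of \<open>\<phi>\<close>.
\<close>

lemma abar2_alt:
  assumes "x \<noteq> 0"
  shows "abar2 x = 1 / (norm x)\<^sup>2 * (7 / 4 * \<beta> x - 1 / 2 * \<alpha> x)
                    + 1 / (norm x)^4 * (15 / 2) * (\<alpha> x - 1)"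
  using assms unfolding abar2_def \<delta>_def by (simp add: field_simps)

lemma bbar2_alt:
  assumes "x \<noteq> 0" "\<beta> x \<noteq> 0"
  shows "bbar2 x = 3 / (4 * (norm x)\<^sup>2)
    + 1 / (norm x)^4 * (\<gamma> x * (3 / 2 + 1 / \<beta> x + 3 * \<gamma> x) - 3 / (2 * \<beta> x) - 4)"
  using assms unfolding bbar2_def \<gamma>_def \<delta>_def
  by (simp add: divide_simps; simp add: algebra_simps eval_nat_numeral)

lemma bbar4_alt:
  assumes "x \<noteq> 0" "\<beta> x \<noteq> 0"
  shows "bbar4 x = 1 / (4 * (norm x)^4)
    + 1 / (norm x)^6 * (1 / (2 * \<beta> x) + 3 / 2 * \<gamma> x + \<gamma> x / \<beta> x + (\<gamma> x)\<^sup>2 - 4)"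
  using assms unfolding bbar4_def \<gamma>_def \<delta>_def
  by (simp add: divide_simps; simp add: algebra_simps eval_nat_numeral)

section \<open>Limits at the origin\<close>

lemma tendsto_radial:
  fixes f :: "'a::real_normed_vector \<Rightarrow> 'b::topological_space"
  assumes "(h \<longlongrightarrow> l) (at_right (0::real))" and "\<And>x. x \<noteq> 0 \<Longrightarrow> f x = h (norm x)"
  shows "(f \<longlongrightarrow> l) (at 0)"
proof -
  have "filterlim (norm :: 'a \<Rightarrow> real) (at_right 0) (at 0)"
    unfolding filterlim_at
    by (auto intro!: tendsto_norm_zero tendsto_ident_at simp: eventually_at_filter)
  then have "((\<lambda>x. h (norm x)) \<longlongrightarrow> l) (at (0::'a))"
    by (rule filterlim_compose[OF assms(1)])
  moreover have "\<forall>\<^sub>F x in at (0::'a). h (norm x) = f x"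
    using assms(2) by (simp add: eventually_at_filter)
  ultimately show ?thesis
    by (rule Lim_transform_eventually)
qed

text \<open>
  In the limits below, single terms have poles of order up to 6 that cancel; in \<open>bbar4\<close> the last
  bracket is \<open>- \<phi>\<^sup>2 / 6 + \<dots>\<close> and leaves the pole \<open>- 1 / (6 \<phi>\<^sup>4)\<close>, which the first summand removes.
\<close>

lemma abar1_tendsto: "(abar1 \<longlongrightarrow> 0) (at 0)"
proof (rule tendsto_radial)
  show "((\<lambda>p::real. 1 / 4 * ((sin (p / 2) / (p / 2))\<^sup>2) + 1 / p\<^sup>2 * (5 / 2 * (sin p / p) - 2 * ((sin (p / 2) / (p / 2))\<^sup>2) - 1 / 2))
      \<longlongrightarrow> 0) (at_right 0)"
    by real_asymp
qed (simp add: abar1_def \<alpha>_def \<beta>_def)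

lemma abar2_tendsto: "(abar2 \<longlongrightarrow> 0) (at 0)"
proof (rule tendsto_radial)
  show "((\<lambda>p::real. 1 / p\<^sup>2 * (7 / 4 * ((sin (p / 2) / (p / 2))\<^sup>2) - 1 / 2 * (sin p / p) - 15 / 2 * ((1 - sin p / p) / p\<^sup>2)))
      \<longlongrightarrow> 0) (at_right 0)"
    by real_asymp
qed (simp add: abar2_def \<alpha>_def \<beta>_def \<delta>_def)

lemma abar3_tendsto: "(abar3 \<longlongrightarrow> - 1 / 180) (at 0)"
proof (rule tendsto_radial)
  show "((\<lambda>p::real. 1 / p\<^sup>2 * (1 / 4 * ((sin (p / 2) / (p / 2))\<^sup>2) + 1 / p\<^sup>2 * (5 / 2 * (sin p / p) - 2 * ((sin (p / 2) / (p / 2))\<^sup>2) - 1 / 2)))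
      \<longlongrightarrow> - 1 / 180) (at_right 0)"
    by real_asymp
qed (simp add: abar3_def abar1_def \<alpha>_def \<beta>_def)

lemma abar4_tendsto: "(abar4 \<longlongrightarrow> - 1 / 1260) (at 0)"
proof (rule tendsto_radial)
  show "((\<lambda>p::real. 1 / p\<^sup>2 * (1 / p\<^sup>2 * (7 / 4 * ((sin (p / 2) / (p / 2))\<^sup>2) - 1 / 2 * (sin p / p) - 15 / 2 * ((1 - sin p / p) / p\<^sup>2))))
      \<longlongrightarrow> - 1 / 1260) (at_right 0)"
    by real_asymp
qed (simp add: abar4_def abar2_def \<alpha>_def \<beta>_def \<delta>_def)

lemma bbar2_tendsto: "(bbar2 \<longlongrightarrow> 0) (at 0)"
proof (rule tendsto_radial)
  show "((\<lambda>p::real. 1 / p\<^sup>2 * (3 / 4 - 3 / 2 * (((1 - sin p / p) / p\<^sup>2) / ((sin (p / 2) / (p / 2))\<^sup>2)))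
        + 1 / p^4 * (((sin p / p) + 3 * (sin p / p)\<^sup>2) / ((sin (p / 2) / (p / 2))\<^sup>2)\<^sup>2 - 4))
      \<longlongrightarrow> 0) (at_right 0)"
    by real_asymp
qed (simp add: bbar2_def \<alpha>_def \<beta>_def \<delta>_def)

lemma bbar4_tendsto: "(bbar4 \<longlongrightarrow> - 1 / 7560) (at 0)"
proof (rule tendsto_radial)
  show "((\<lambda>p::real. 1 / p^4 * (1 / 4 - 1 / 2 * (((1 - sin p / p) / p\<^sup>2) / ((sin (p / 2) / (p / 2))\<^sup>2)))
        + 1 / p^6 * ((1 + (sin p / p)) * ((sin p / p) / ((sin (p / 2) / (p / 2))\<^sup>2)\<^sup>2 + 1 / ((sin (p / 2) / (p / 2))\<^sup>2)) - 4))
      \<longlongrightarrow> - 1 / 7560) (at_right 0)"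
    by real_asymp
qed (simp add: bbar4_def \<alpha>_def \<beta>_def \<delta>_def)

section \<open>The derivative formulas and their limits\<close>

theorem lemma2:
  fixes x y u v :: "real^3"
  shows
    "(norm x \<noteq> 0 \<longrightarrow>
        has_dir_deriv (\<lambda>X :: (real^3) \<times> (real^3). a1 (fst X)) (x, y) (u, v) ((x \<bullet> u) * abar1 x)
      \<and> has_dir_deriv (\<lambda>X :: (real^3) \<times> (real^3). a2 (fst X)) (x, y) (u, v) ((x \<bullet> u) * abar2 x)
      \<and> has_dir_deriv (\<lambda>X :: (real^3) \<times> (real^3). a3 (fst X)) (x, y) (u, v) ((x \<bullet> u) * abar3 x)
      \<and> has_dir_deriv (\<lambda>X :: (real^3) \<times> (real^3). a4 (fst X)) (x, y) (u, v) ((x \<bullet> u) * abar4 x)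
      \<and> abar2 x = 1 / (norm x)\<^sup>2 * (7 / 4 * \<beta> x - 1 / 2 * \<alpha> x)
                    + 1 / (norm x)^4 * (15 / 2) * (\<alpha> x - 1))
   \<and> (norm x \<noteq> 0 \<and> \<beta> x \<noteq> 0 \<longrightarrow>
        has_dir_deriv (\<lambda>X :: (real^3) \<times> (real^3). b1 (fst X)) (x, y) (u, v) 0
      \<and> has_dir_deriv (\<lambda>X :: (real^3) \<times> (real^3). b2 (fst X)) (x, y) (u, v) ((x \<bullet> u) * bbar2 x)
      \<and> has_dir_deriv (\<lambda>X :: (real^3) \<times> (real^3). b3 (fst X)) (x, y) (u, v) 0
      \<and> has_dir_deriv (\<lambda>X :: (real^3) \<times> (real^3). b4 (fst X)) (x, y) (u, v) ((x \<bullet> u) * bbar4 x)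
      \<and> bbar2 x = 3 / (4 * (norm x)\<^sup>2)
                    + 1 / (norm x)^4 * (\<gamma> x * (3 / 2 + 1 / \<beta> x + 3 * \<gamma> x) - 3 / (2 * \<beta> x) - 4)
      \<and> bbar4 x = 1 / (4 * (norm x)^4)
                    + 1 / (norm x)^6 * (1 / (2 * \<beta> x) + 3 / 2 * \<gamma> x + \<gamma> x / \<beta> x + (\<gamma> x)\<^sup>2 - 4))
   \<and> (abar1 \<longlongrightarrow> 0) (at 0)
   \<and> (abar2 \<longlongrightarrow> 0) (at 0)
   \<and> (abar3 \<longlongrightarrow> - 1 / 180) (at 0)
   \<and> (abar4 \<longlongrightarrow> - 1 / 1260) (at 0)
   \<and> (bbar2 \<longlongrightarrow> 0) (at 0)
   \<and> (bbar4 \<longlongrightarrow> - 1 / 7560) (at 0)"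
proof -
  have "((\<lambda>t. b1 (x + t *\<^sub>R u)) has_real_derivative 0) (at 0)"
    and "((\<lambda>t. b3 (x + t *\<^sub>R u)) has_real_derivative 0) (at 0)"
    by (simp_all add: b1_def b3_def)
  then show ?thesis
    unfolding has_dir_deriv_fst norm_eq_zero
    by (intro conjI impI a1_along_line a2_along_line a3_along_line a4_along_line abar2_alt
          b2_along_line b4_along_line bbar2_alt bbar4_alt
          abar1_tendsto abar2_tendsto abar3_tendsto abar4_tendsto bbar2_tendsto bbar4_tendsto)
       simp_all
qed

end
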